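(* Let $n\ge1$, $\delta>0$, $\beta<n+4$, and let $b\in H^s(T^n)$ (for some $s\in\mathbb{R}$) be such that $\sum_{k\in\mathbb{Z}^n}|\hat b_k|<\infty$. Let $$u(x,t)=\hat b_0t+\sum_{0\ne k\in\mathbb{Z}^n}\frac{e^{m(\nu_k)t}-1}{m(\nu_k)}\hat b_k e^{i\nu_k\cdot x}$$ be the solution of $u_t=L^{\delta,\beta}u+b$ on $T^n\times(0,\infty)$, $u(\cdot,0)=0$. Then $u(x,\cdot)\in C^\infty((0,\infty))$ for all $x\in T^n$.
   Context: Let $r_1,\dots,r_n>0$ and let $T^n=\prod_{i=1}^n[0,r_i]$ be the periodic torus (opposite faces identified). For $k\in\mathbb{Z}^n$ put $\nu_k=\left(\frac{2\pi k_1}{r_1},\dots,\frac{2\pi k_n}{r_n}\right)$. A periodic distribution $h$ on $T^n$ is written through its Fourier coefficients as $h=\sum_{k\in\mathbb{Z}^n}\hat h_k e^{i\nu_k\cdot x}$. For $s\in\mathbb{R}$, $H^s(T^n)$ is the space of periodic distributions with $\|h\|_{H^s(T^n)}^2:=\sum_{k\in\mathbb{Z}^n}(1+\|k\|^2)^s|\hat h_k|^2<\infty$. For $n\ge1$, $\delta>0$, $\beta<n+4$, the Fourier multiplier is $$m(\nu)=m^{\delta,\beta}(\nu)=-\|\nu\|^2\;{}_2F_3\!\left(1,\tfrac{n+2-\beta}{2};\,2,\tfrac{n+2}{2},\tfrac{n+4-\beta}{2};\,-\tfrac14\|\nu\|^2\delta^2\right),\quad \nu\in\mathbb{R}^n.$$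 For $\beta<n+2$ it equals $c^{\delta,\beta}\int_{B_\delta(0)}\frac{\cos(\nu\cdot z)-1}{\|z\|^\beta}dz$ with $c^{\delta,\beta}=\frac{2(n+2-\beta)\Gamma(\frac n2+1)}{\pi^{n/2}\delta^{n+2-\beta}}$; for $\beta=n+2$ it equals $-\|\nu\|^2$. The operator $L^{\delta,\beta}$ acts by $L^{\delta,\beta}J=\sum_{k}m(\nu_k)\hat J_k e^{i\nu_k\cdot x}$. Differentiability in $t$ is in the classical sense. *)

theory Defs
  imports "HOL-Analysis.Analysis"
begin

section \<open>Smooth functions\<close>

definition partial_deriv ::
  "'n::finite \<Rightarrow> (real^'n \<Rightarrow> complex) \<Rightarrow> real^'n \<Rightarrow> complex" where
  "partial_deriv i \<phi> x = vector_derivative (\<lambda>t. \<phi> (x + t *\<^sub>R axis i 1)) (at 0)"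

definition iter_partial_deriv ::
  "'n::finite list \<Rightarrow> (real^'n \<Rightarrow> complex) \<Rightarrow> real^'n \<Rightarrow> complex" where
  "iter_partial_deriv is \<phi> = foldr partial_deriv is \<phi>"

text \<open>Differentiability of every iterated derivative makes all of them continuous, so
  the following two predicates are membership in \<open>C\<^sup>\<infinity>\<close>. The second one is meant
  for open \<open>S\<close>: the derivative is two-sided and, at the points of an open set,
  independent of the values outside it.\<close>

definition C_infinity :: "(real^'n::finite \<Rightarrow> complex) \<Rightarrow> bool" where
  "C_infinity \<phi> \<longleftrightarrow> (\<forall>is. iter_partial_deriv is \<phi> differentiable_on UNIV)"

definition C_infinity_on :: "real set \<Rightarrow> (real \<Rightarrow> complex) \<Rightarrow> bool" where
  "C_infinity_on S f \<longleftrightarrow>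
     (\<forall>j. \<forall>t\<in>S. ((\<lambda>g t. vector_derivative g (at t)) ^^ j) f differentiable (at t))"

section \<open>Periodic distributions\<close>

text \<open>The vector \<open>r\<close> collects the side lengths; the torus is the box \<open>cbox 0 r\<close>, and
  functions on it are \<open>r\<close>-periodic functions on the whole space.\<close>

definition test_function :: "real^'n::finite \<Rightarrow> (real^'n \<Rightarrow> complex) \<Rightarrow> bool" where
  "test_function r \<phi> \<longleftrightarrow>
     C_infinity \<phi> \<and> (\<forall>i x. \<phi> (x + (r $ i) *\<^sub>R axis i 1) = \<phi> x)"

text \<open>Complex linear functionals on the test functions that are continuous for the topology
  of uniform convergence of all derivatives; the last clause says that \<open>h\<close> is bounded by a
  constant times the \<open>C\<^sup>N\<close> norm. Only the values of \<open>h\<close> on test functions matter.\<close>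

definition periodic_distribution ::
  "real^'n::finite \<Rightarrow> ((real^'n \<Rightarrow> complex) \<Rightarrow> complex) \<Rightarrow> bool" where
  "periodic_distribution r h \<longleftrightarrow>
     (\<forall>\<phi> \<psi>. test_function r \<phi> \<longrightarrow> test_function r \<psi> \<longrightarrow>
        h (\<lambda>x. \<phi> x + \<psi> x) = h \<phi> + h \<psi>) \<and>
     (\<forall>c \<phi>. test_function r \<phi> \<longrightarrow> h (\<lambda>x. c * \<phi> x) = c * h \<phi>) \<and>
     (\<exists>N C. \<forall>\<phi> M. test_function r \<phi> \<longrightarrow>
        (\<forall>is x. length is \<le> N \<longrightarrow> cmod (iter_partial_deriv is \<phi> x) \<le> M) \<longrightarrow>
        cmod (h \<phi>) \<le> C * M)"

definition freq :: "real^'n::finite \<Rightarrow> int^'n \<Rightarrow> real^'n" where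
  "freq r k = (\<chi> i. 2 * pi * of_int (k $ i) / r $ i)"

text \<open>A function \<open>f\<close> acts by \<open>\<phi> \<mapsto> \<integral> f \<phi>\<close> over the box, whence the normalization by
  its volume: a function \<open>f\<close> that is a sum of \<open>f\<^sub>k e\<^sup>i\<^sup>\<nu>\<^sup>x\<close> with \<open>\<nu> = freq r k\<close> has the
  coefficients \<open>f\<^sub>k\<close>.\<close>

definition fourier_coeff ::
  "real^'n::finite \<Rightarrow> ((real^'n \<Rightarrow> complex) \<Rightarrow> complex) \<Rightarrow> int^'n \<Rightarrow> complex" where
  "fourier_coeff r h k =
     h (\<lambda>x. cis (- (freq r k \<bullet> x))) / of_real (\<Prod>i\<in>UNIV. r $ i)"

definition sobolev ::
  "real^'n::finite \<Rightarrow> real \<Rightarrow> ((real^'n \<Rightarrow> complex) \<Rightarrow> complex) set" where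
  "sobolev r s = {h. periodic_distribution r h \<and>
     (\<lambda>k :: int^'n. (1 + (norm (\<chi> i. real_of_int (k $ i)))\<^sup>2) powr s * (cmod (fourier_coeff r h k))\<^sup>2)
       summable_on UNIV}"

section \<open>The Fourier multiplier and the solution\<close>

definition hypergeometric :: "real list \<Rightarrow> real list \<Rightarrow> real \<Rightarrow> real" where
  "hypergeometric as bs z = eval_fps (fps_hypergeo as bs 1) z"

definition multiplier :: "real \<Rightarrow> real \<Rightarrow> real^'n::finite \<Rightarrow> real" where
  "multiplier \<delta> \<beta> \<nu> =
     (let n = real CARD('n) in
      - (norm \<nu>)\<^sup>2 *
        hypergeometric [1, (n + 2 - \<beta>) / 2] [2, (n + 2) / 2, (n + 4 - \<beta>) / 2]
          (- (1 / 4) * (norm \<nu>)\<^sup>2 * \<delta>\<^sup>2))"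

text \<open>The Fourier series of the solution of \<open>u\<^sub>t = L u + b\<close>, \<open>u(\<cdot>,0) = 0\<close>, where \<open>L\<close> multiplies
  the coefficient with index \<open>k\<close> by \<open>multiplier \<delta> \<beta> (freq r k)\<close>; for \<open>\<beta> < n + 4\<close> this is
  negative unless \<open>k = 0\<close>, so that the quotients below are proper ones.\<close>

definition solution ::
  "real^'n::finite \<Rightarrow> real \<Rightarrow> real \<Rightarrow> ((real^'n \<Rightarrow> complex) \<Rightarrow> complex) \<Rightarrow>
   real^'n \<Rightarrow> real \<Rightarrow> complex" where
  "solution r \<delta> \<beta> b x t =
     fourier_coeff r b 0 * of_real t +
     (\<Sum>\<^sub>\<infinity>k\<in>UNIV - {0}.
        of_real ((exp (multiplier \<delta> \<beta> (freq r k) * t) - 1) / multiplier \<delta> \<beta> (freq r k)) *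
        fourier_coeff r b k * cis (freq r k \<bullet> x))"

end

theory Submission
  imports Defs
begin

text \<open>For \<open>t \<ge> a > 0\<close> the \<open>t\<close>-derivatives of the terms of the series are bounded by
  \<open>\<bar>m\<bar>\<^sup>j e\<^sup>m\<^sup>t \<bar>b\<^sub>k\<bar> \<le> (j! / a\<^sup>j) \<bar>b\<^sub>k\<bar>\<close> as soon as \<open>m \<le> 0\<close>, so the series may be
  differentiated termwise.

  That \<open>m \<le> 0\<close> is seen as follows. Let \<open>G\<^sub>p(z) = \<^sub>0F\<^sub>1(; p; z)\<close> with \<open>p = n / 2\<close>. By the equation
  \<open>z G'' + p G' = G\<close> the energy \<open>G\<^sup>2 - z G'\<^sup>2\<close> increases on \<open>z \<le> 0\<close> if \<open>p \<ge> 1/2\<close>, whence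
  \<open>G\<^sub>p \<le> 1\<close> there; since \<open>p G\<^sub>p' = G\<^sub>p\<^sub>+\<^sub>1\<close>, also \<open>G\<^sub>p(z) \<ge> 1 + z / p\<close>. With \<open>a = (n + 2 - \<beta>) / 2\<close> the
  function \<open>F = \<^sub>2F\<^sub>3\<close> of the multiplier satisfies \<open>z F' + a F = a p (G\<^sub>p - 1) / z\<close>. For \<open>a > 0\<close>
  the right-hand side is nonnegative on \<open>z < 0\<close>, which excludes a negative minimum of \<open>F\<close>. For
  \<open>-1 < a \<le> 0\<close> the same argument applied to \<open>R = (F - 1) / z\<close>, for which
  \<open>z R' + (a + 1) R = a (p (G\<^sub>p - 1) - z) / z\<^sup>2\<close>, gives \<open>R \<le> 0\<close> and so \<open>F \<ge> 1\<close>.\<close>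

section \<open>Sign of the multiplier\<close>

text \<open>If \<open>f\<close> has a negative minimum over \<open>{z..0}\<close> at
  \<open>w\<close>, then \<open>f 0 \<ge> 0\<close> forces \<open>w < 0\<close>, which leaves room
  to the right of \<open>w\<close> and gives \<open>f' w \<ge> 0\<close>. Both summands of the
  inequality then have the wrong sign at \<open>w\<close>. Only the right side is used, since
  \<open>w = z\<close> is possible.\<close>

lemma nonneg_of_deriv_ineq:
  fixes f f' :: "real \<Rightarrow> real"
  assumes f: "\<And>z. z \<le> 0 \<Longrightarrow> (f has_real_derivative f' z) (at z)"
    and "e > 0" and f0: "f 0 \<ge> 0"
    and ineq: "\<And>z. z < 0 \<Longrightarrow> z * f' z + e * f z \<ge> 0"
    and "z \<le> 0"
  shows "f z \<ge> 0"
proof (rule ccontr)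
  assume neg: "\<not> f z \<ge> 0"
  have "continuous_on {z..0} f"
    by (rule DERIV_continuous_on[where D = f']) (auto intro: f has_field_derivative_at_within)
  then obtain w where w: "w \<in> {z..0}" and min: "\<And>y. y \<in> {z..0} \<Longrightarrow> f w \<le> f y"
    using continuous_attains_inf[of "{z..0}" f] \<open>z \<le> 0\<close> by auto
  have fw: "f w < 0"
    using min[of z] neg \<open>z \<le> 0\<close> by auto
  with f0 w have "w < 0"
    by (cases "w = 0") auto
  have "f' w \<ge> 0"
  proof (rule ccontr)
    assume "\<not> f' w \<ge> 0"
    with f[of w] \<open>w < 0\<close> obtain d where d: "d > 0" "\<And>h. 0 < h \<Longrightarrow> h < d \<Longrightarrow> f (w + h) < f w"
      using DERIV_neg_dec_right[of f "f' w" w] by force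
    \<comment> \<open>Within the range of decrease and not past 0, so that \<open>w + h\<close>
      competes in the minimum.\<close>
    define h where "h = min (d / 2) (- w)"
    have "0 < h" "h < d" "w + h \<in> {z..0}"
      using d(1) \<open>w < 0\<close> w by (auto simp: h_def)
    with d(2) min[of "w + h"] show False
      by force
  qed
  with \<open>w < 0\<close> have "w * f' w \<le> 0"
    by (simp add: mult_nonpos_nonneg)
  moreover have "e * f w < 0"
    using \<open>e > 0\<close> fw by (simp add: mult_pos_neg)
  ultimately show False
    using ineq[OF \<open>w < 0\<close>] by linarith
qed

section \<open>Entire power series and the function 0F1\<close>

lemma fps_conv_radius_infinite:
  fixes f :: "real fps"
  assumes "\<And>n. \<bar>fps_nth f n\<bar> \<le> C * D ^ n / fact n"
  shows "fps_conv_radius f = \<infinity>"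
proof -
  have "summable (\<lambda>n. fps_nth f n * of_real r ^ n)" for r :: real
  proof (rule summable_comparison_test)
    show "\<exists>N. \<forall>n\<ge>N. norm (fps_nth f n * of_real r ^ n) \<le> C * (inverse (fact n) * (D * \<bar>r\<bar>) ^ n)"
      using mult_right_mono[OF assms, of "\<bar>r\<bar> ^ n" for n]
      by (auto simp: abs_mult power_abs field_simps)
    show "summable (\<lambda>n. C * (inverse (fact n) * (D * \<bar>r\<bar>) ^ n))"
      by (intro summable_mult summable_exp)
  qed
  then show ?thesis
    unfolding fps_conv_radius_def by (intro conv_radius_inftyI'') auto
qed

lemma pochhammer_ge_power:
  fixes p :: real
  assumes "p > 0"
  shows "pochhammer p n \<ge> p ^ n"
proof (induction n)
  case (Suc n)
  have "p * p ^ n \<le> (p + real n) * pochhammer p n"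
    using assms Suc by (intro mult_mono) auto
  then show ?case
    by (simp add: pochhammer_rec')
qed auto

text \<open>At z = -x^2/4 with x > 0 this series is Gamma(p) (x/2)^(1-p) times the Bessel function
  of the first kind of order p - 1 at x.\<close>

definition fps_0F1 :: "real \<Rightarrow> real fps" where
  "fps_0F1 p = Abs_fps (\<lambda>n. 1 / (fact n * pochhammer p n))"

lemma fps_conv_radius_0F1:
  assumes "p > 0"
  shows "fps_conv_radius (fps_0F1 p) = \<infinity>"
proof (rule fps_conv_radius_infinite)
  fix n
  have "1 / pochhammer p n \<le> 1 / p ^ n"
    using pochhammer_ge_power[OF assms, of n] assms by (intro divide_left_mono) (auto simp: pochhammer_pos)
  then have "1 / pochhammer p n / fact n \<le> 1 / p ^ n / fact n"
    by (rule divide_right_mono) simp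
  then show "\<bar>fps_nth (fps_0F1 p) n\<bar> \<le> 1 * (1 / p) ^ n / fact n"
    using assms pochhammer_pos[OF assms, of n] by (simp add: fps_0F1_def power_divide field_simps)
qed

lemma fps_deriv_0F1:
  assumes "p > 0"
  shows "fps_deriv (fps_0F1 p) = fps_const (1 / p) * fps_0F1 (p + 1)"
proof (rule fps_ext)
  fix n
  have "pochhammer (p + 1) n > 0"
    using assms by (simp add: pochhammer_pos)
  moreover have "fact (Suc n) = (real n + 1) * fact n" "real n + 1 \<noteq> 0"
    by (simp_all add: algebra_simps)
  ultimately show "fps_nth (fps_deriv (fps_0F1 p)) n = fps_nth (fps_const (1 / p) * fps_0F1 (p + 1)) n"
    using assms by (simp add: fps_0F1_def pochhammer_rec add.commute del: fact_Suc)
qed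

lemma eval_0F1_deriv:
  assumes "p > 0"
  shows "(eval_fps (fps_0F1 p) has_real_derivative eval_fps (fps_0F1 (p + 1)) z / p) (at z)"
proof -
  have "(eval_fps (fps_0F1 p) has_real_derivative eval_fps (fps_deriv (fps_0F1 p)) z) (at z)"
    using assms by (intro has_field_derivative_eval_fps) (simp add: fps_conv_radius_0F1)
  moreover have "eval_fps (fps_deriv (fps_0F1 p)) z = eval_fps (fps_0F1 (p + 1)) z / p"
    unfolding fps_deriv_0F1[OF assms] using assms
    by (subst eval_fps_mult) (simp_all add: fps_conv_radius_0F1)
  ultimately show ?thesis
    by simp
qed

text \<open>The equation z G'' + p G' = G in series form: by \<open>fps_deriv_0F1\<close>, G' and
  G'' are the series with parameters \<open>p + 1\<close> and \<open>p + 2\<close>, divided by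
  \<open>p\<close> and by \<open>p * (p + 1)\<close>.\<close>

lemma fps_0F1_recurrence:
  assumes "p > 0"
  shows "fps_const (1 / (p * (p + 1))) * fps_0F1 (p + 2) * fps_X + fps_0F1 (p + 1) = fps_0F1 p"
proof (rule fps_ext)
  fix n
  show "fps_nth (fps_const (1 / (p * (p + 1))) * fps_0F1 (p + 2) * fps_X + fps_0F1 (p + 1)) n
    = fps_nth (fps_0F1 p) n"
  proof (cases n)
    case (Suc m)
    let ?P = "pochhammer (p + 2) m"
    have pos: "?P > 0"
      using assms by (simp add: pochhammer_pos)
    \<comment> \<open>All symbols are reduced to \<open>?P\<close>; in \<open>e2\<close> both sides
      are \<open>pochhammer p (m + 2)\<close>, split at its last and at its first factor.\<close>
    have e1: "pochhammer (p + 1) (Suc m) = (p + 1) * ?P"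
      by (simp add: pochhammer_rec algebra_simps)
    have e2: "(p + 1 + m) * pochhammer p (Suc m) = p * pochhammer (p + 1) (Suc m)"
      by (simp only: pochhammer_rec[of p] pochhammer_rec'[of "p + 1" m] mult.left_commute)
    have e3: "pochhammer p (Suc m) = p * (p + 1) * ?P / (p + 1 + m)"
      using e1 e2 assms by (simp add: field_simps)
    \<comment> \<open>To be read with \<open>F\<close> as m! and \<open>M\<close> as m + 1, so that
      \<open>M * F\<close> is (m + 1)!.\<close>
    have fractions: "1 / (x * y * (F * P)) + 1 / (M * F * (y * P)) = 1 / (M * F * (x * y * P / (x + M)))"
      if "x > 0" "y > 0" "F > 0" "P > 0" "M > 0" for x y F P M :: real
      using that by (simp add: field_simps)
    show ?thesis
      using assms pos fractions[of p "p + 1" "fact m" ?P "1 + real m"] unfolding Suc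
      by (simp add: fps_0F1_def e1 e3 add.assoc del: pochhammer_Suc)
  qed (simp add: fps_0F1_def)
qed

lemma eval_0F1_recurrence:
  assumes "p > 0"
  shows "z * eval_fps (fps_0F1 (p + 2)) z / (p * (p + 1)) + eval_fps (fps_0F1 (p + 1)) z
    = eval_fps (fps_0F1 p) z"
proof -
  have r: "fps_conv_radius (fps_0F1 (p + 2)) = \<infinity>" "fps_conv_radius (fps_0F1 (p + 1)) = \<infinity>"
    using assms by (auto intro!: fps_conv_radius_0F1)
  have r1: "fps_conv_radius (fps_const (1 / (p * (p + 1))) * fps_0F1 (p + 2)) = \<infinity>"
    using fps_conv_radius_mult[of "fps_const (1 / (p * (p + 1)))" "fps_0F1 (p + 2)"] by (simp add: r)
  have r2: "fps_conv_radius (fps_const (1 / (p * (p + 1))) * fps_0F1 (p + 2) * fps_X) = \<infinity>"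
    using fps_conv_radius_mult[of "fps_const (1 / (p * (p + 1))) * fps_0F1 (p + 2)" fps_X]
    by (simp add: r1)
  show ?thesis
    unfolding fps_0F1_recurrence[OF assms, symmetric]
    by (simp add: eval_fps_add eval_fps_mult r r1 r2)
qed

lemma eval_0F1_le_1:
  assumes "p \<ge> 1 / 2" "z \<le> 0"
  shows "eval_fps (fps_0F1 p) z \<le> 1"
proof -
  define G where "G q = eval_fps (fps_0F1 q)" for q
  have p: "p > 0"
    using assms by simp
  define D where "D x = G (p + 1) x / p" for x
  define T where "T x = G (p + 2) x / (p + 1) / p" for x
  have dG: "(G p has_real_derivative D x) (at x)" for x
    unfolding G_def D_def using p by (rule eval_0F1_deriv)
  have dD: "(D has_real_derivative T x) (at x)" for x
    unfolding D_def[abs_def] T_def using eval_0F1_deriv[of "p + 1" x] p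
    by (intro DERIV_cdivide) (simp add: G_def add.assoc)
  define E where "E x = (G p x)\<^sup>2 - x * (D x)\<^sup>2" for x
  have dE: "(E has_real_derivative (2 * p - 1) * (D x)\<^sup>2) (at x)" for x
  proof -
    have "(E has_real_derivative 2 * G p x * D x - ((D x)\<^sup>2 + x * (2 * D x * T x))) (at x)"
      unfolding E_def by (auto intro!: derivative_eq_intros dG dD)
    \<comment> \<open>Here \<open>D\<close> and \<open>T\<close> are G' and G''. The differential
      equation turns E' = 2 D (G - x T) - D^2 into (2 p - 1) D^2.\<close>
    moreover have "G p x = x * T x + p * D x"
      using eval_0F1_recurrence[OF p, of x] p by (simp add: G_def D_def T_def mult.commute)
    then have "2 * G p x * D x - ((D x)\<^sup>2 + x * (2 * D x * T x)) = (2 * p - 1) * (D x)\<^sup>2"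
      by algebra
    ultimately show ?thesis
      by simp
  qed
  have "E z \<le> E 0"
  proof (rule DERIV_nonneg_imp_nondecreasing[OF assms(2)], intro exI conjI)
    fix x
    show "(E has_real_derivative (2 * p - 1) * (D x)\<^sup>2) (at x)"
      by (rule dE)
    show "(2 * p - 1) * (D x)\<^sup>2 \<ge> 0"
      using assms(1) by simp
  qed
  also have "E 0 = 1"
    by (simp add: E_def G_def eval_fps_at_0 fps_0F1_def)
  \<comment> \<open>For \<open>z \<le> 0\<close> the term - z D^2 is nonnegative, so
    \<open>E z\<close> dominates the square of \<open>G p z\<close>.\<close>
  finally have "(G p z)\<^sup>2 \<le> 1"
    using mult_nonpos_nonneg[OF assms(2), of "(D z)\<^sup>2"] by (simp add: E_def)
  then show ?thesis
    using power2_le_imp_le[of "G p z" 1] by (simp add: G_def)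
qed

text \<open>The bound is the tangent at 0. The difference has a nonpositive derivative by
  \<open>eval_0F1_le_1\<close> at \<open>p + 1\<close>, so it can only grow towards the
  left.\<close>

lemma eval_0F1_ge:
  assumes "p \<ge> 1 / 2" "z \<le> 0"
  shows "eval_fps (fps_0F1 p) z \<ge> 1 + z / p"
proof -
  define D where "D x = eval_fps (fps_0F1 p) x - x / p" for x
  have "D z \<ge> D 0"
  proof (rule DERIV_nonpos_imp_nonincreasing[OF assms(2)], intro exI conjI)
    fix x :: real
    assume "z \<le> x" "x \<le> 0"
    show "(D has_real_derivative eval_fps (fps_0F1 (p + 1)) x / p - 1 / p) (at x)"
      unfolding D_def using assms by (auto intro!: derivative_eq_intros eval_0F1_deriv)
    show "eval_fps (fps_0F1 (p + 1)) x / p - 1 / p \<le> 0"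
      using eval_0F1_le_1[of "p + 1" x] assms \<open>x \<le> 0\<close> by (simp add: field_simps)
  qed
  then show ?thesis
    by (simp add: D_def eval_fps_at_0 fps_0F1_def)
qed

section \<open>Sign of the function 2F3\<close>

lemma hypergeometric_nonneg:
  fixes a p z :: real
  assumes a: "a > -1" and p: "p \<ge> 1 / 2" and z: "z \<le> 0"
  shows "hypergeometric [1, a] [2, p + 1, a + 1] z \<ge> 0"
proof -
  define f where "f = fps_hypergeo [1, a] [2, p + 1, a + 1] 1"
  define F where "F = eval_fps f"
  define F' where "F' = eval_fps (fps_deriv f)"
  define G where "G = eval_fps (fps_0F1 p)"
  have poch2: "pochhammer 2 k = (fact (Suc k) :: real)" for k
    using pochhammer_rec[of "1 :: real" k] by (simp add: pochhammer_fact)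
  have pos1: "pochhammer (p + 1) k > 0" and posa: "pochhammer (a + 1) k > 0" for k
    using a p by (auto intro!: pochhammer_pos)
  \<comment> \<open>The numerator parameter 1 cancels the factorial of the series; (k + 1)! comes
    from the parameter 2.\<close>
  have f_nth: "fps_nth f k =
      pochhammer a k / (fact (Suc k) * pochhammer (p + 1) k * pochhammer (a + 1) k)" for k
    unfolding f_def fps_hypergeo_nth foldl_Cons foldl_Nil poch2 pochhammer_fact[symmetric]
    by (simp add: mult_ac del: fact_Suc)
  \<comment> \<open>Both sides are \<open>pochhammer a (Suc k)\<close>. Hence applying z d/dz + a,
    which multiplies coefficient k by a + k, removes the parameter \<open>a + 1\<close> and leaves a
    shifted 0F1.\<close>
  have poch_a: "(a + real k) * pochhammer a k = a * pochhammer (a + 1) k" for k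
    by (metis pochhammer_rec pochhammer_rec')
  have f_rec: "(a + real k) * fps_nth f k = a / (fact (Suc k) * pochhammer (p + 1) k)" for k
    unfolding f_nth times_divide_eq_right poch_a using posa[of k] by simp
  have radius: "fps_conv_radius f = \<infinity>"
  proof (rule fps_conv_radius_infinite)
    fix k
    \<comment> \<open>For k \<ge> 1 the ratio bounded below is |a| / (a + k), at most |a| / (a + 1).
      The summand 1 covers k = 0, where a + k need not be positive.\<close>
    define C where "C = 1 + \<bar>a\<bar> / (a + 1)"
    have "\<bar>pochhammer a k\<bar> \<le> C * pochhammer (a + 1) k"
    proof (cases "k = 0")
      case True
      then show ?thesis
        using a by (simp add: C_def)
    next
      case False
      then have k: "a + real k \<ge> a + 1" and k0: "a + real k > 0"
        using a by auto
      have "(a + real k) * \<bar>pochhammer a k\<bar> = \<bar>a\<bar> * pochhammer (a + 1) k"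
        using arg_cong[OF poch_a[of k], of abs] k0 posa[of k] by (simp only: abs_mult abs_of_pos)
      then have "\<bar>pochhammer a k\<bar> = \<bar>a\<bar> / (a + real k) * pochhammer (a + 1) k"
        using k0 by (simp add: field_simps)
      also have "\<dots> \<le> C * pochhammer (a + 1) k"
      proof (rule mult_right_mono)
        have "\<bar>a\<bar> / (a + real k) \<le> \<bar>a\<bar> / (a + 1)"
          using k k0 a by (intro divide_left_mono mult_pos_pos) auto
        then show "\<bar>a\<bar> / (a + real k) \<le> C"
          by (simp add: C_def)
      qed (use posa[of k] in simp)
      finally show ?thesis .
    qed
    then have C: "\<bar>pochhammer a k\<bar> / pochhammer (a + 1) k \<le> C"
      using posa[of k] by (simp add: field_simps)
    have q: "1 / pochhammer (p + 1) k \<le> (1 / (p + 1)) ^ k"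
      using pochhammer_ge_power[of "p + 1" k] p pos1[of k]
      by (simp add: power_divide frac_le)
    have s: "1 / fact (Suc k) \<le> (1 / fact k :: real)"
      by (intro divide_left_mono fact_mono) auto
    have "\<bar>fps_nth f k\<bar> =
        (\<bar>pochhammer a k\<bar> / pochhammer (a + 1) k) * (1 / pochhammer (p + 1) k) * (1 / fact (Suc k))"
      unfolding f_nth using pos1[of k] posa[of k] by (simp add: abs_mult)
    also have "\<dots> \<le> C * (1 / (p + 1)) ^ k * (1 / fact k)"
      using C q s a p pos1[of k] posa[of k] by (intro mult_mono) (auto simp: C_def)
    finally show "\<bar>fps_nth f k\<bar> \<le> C * (1 / (p + 1)) ^ k / fact k"
      by simp
  qed
  have radius': "fps_conv_radius (fps_deriv f) = \<infinity>"
    using fps_conv_radius_deriv[of f] radius by simp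
  have dF: "(F has_real_derivative F' x) (at x)" for x
    unfolding F_def F'_def by (rule has_field_derivative_eval_fps) (simp add: radius)
  have F0: "F 0 = 1"
    by (simp add: F_def eval_fps_at_0 f_def)
  \<comment> \<open>Multiplied by \<open>x\<close>, the differential equation involves no division
    and is an identity of series; its coefficient k + 1 is \<open>f_rec\<close>.\<close>
  have key: "x * (x * F' x + a * F x) = a * p * (G x - 1)" for x
  proof -
    have p0: "p > 0"
      using p by simp
    have "fps_X * (fps_X * fps_deriv f + fps_const a * f) = fps_const (a * p) * (fps_0F1 p - 1)"
    proof (rule fps_ext)
      fix n
      show "fps_nth (fps_X * (fps_X * fps_deriv f + fps_const a * f)) n =
          fps_nth (fps_const (a * p) * (fps_0F1 p - 1)) n"
      proof (cases n)
        case (Suc k)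
        have "fps_nth (fps_X * (fps_X * fps_deriv f + fps_const a * f)) n = (a + real k) * fps_nth f k"
          unfolding Suc by (cases k) (simp_all add: algebra_simps)
        also have "\<dots> = fps_nth (fps_const (a * p) * (fps_0F1 p - 1)) n"
          unfolding f_rec Suc using p0 by (simp add: fps_0F1_def pochhammer_rec)
        finally show ?thesis .
      qed (simp add: fps_0F1_def)
    qed
    then have "eval_fps (fps_X * (fps_X * fps_deriv f + fps_const a * f)) x =
        eval_fps (fps_const (a * p) * (fps_0F1 p - 1)) x"
      by simp
    moreover have r1: "fps_conv_radius (fps_const a * f) = \<infinity>"
      using fps_conv_radius_mult[of "fps_const a" f] by (simp add: radius)
    moreover have r2: "fps_conv_radius (fps_X * fps_deriv f) = \<infinity>"
      using fps_conv_radius_mult[of fps_X "fps_deriv f"] by (simp add: radius')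
    moreover have "fps_conv_radius (fps_X * fps_deriv f + fps_const a * f) = \<infinity>"
      using fps_conv_radius_add[of "fps_X * fps_deriv f" "fps_const a * f"] r1 r2 by simp
    moreover have "fps_conv_radius (fps_0F1 p - 1) = \<infinity>"
      using fps_conv_radius_diff[of "fps_0F1 p" 1] fps_conv_radius_0F1[OF p0] by simp
    ultimately show ?thesis
      using fps_conv_radius_0F1[OF p0]
      by (simp add: eval_fps_mult eval_fps_add eval_fps_diff radius radius' F_def F'_def G_def)
  qed
  have "F z \<ge> 0"
  proof (cases "a > 0")
    case True
    show ?thesis
    proof (rule nonneg_of_deriv_ineq[OF dF True _ _ z])
      fix x :: real
      assume "x < 0"
      have "x * (x * F' x + a * F x) \<le> 0"
        unfolding key G_def using eval_0F1_le_1[OF p, of x] \<open>x < 0\<close> True p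
        by (simp add: mult_nonneg_nonpos)
      then show "x * F' x + a * F x \<ge> 0"
        using \<open>x < 0\<close> by (simp add: mult_le_0_iff)
    qed (simp add: F0)
  next
    case False
    \<comment> \<open>The minimum principle needs a positive factor \<open>e\<close>, which
      \<open>a\<close> no longer is; for R it becomes \<open>a + 1\<close>. The shift defines (F -
      1) / z at 0 as well.\<close>
    define R where "R = eval_fps (fps_shift 1 f)"
    define R' where "R' = eval_fps (fps_deriv (fps_shift 1 f))"
    have dR: "(R has_real_derivative R' x) (at x)" for x
      unfolding R_def R'_def by (rule has_field_derivative_eval_fps) (simp add: radius)
    have FR: "F x = 1 + x * R x" for x
    proof -
      have "f = 1 + fps_X * fps_shift 1 f"
      proof (rule fps_ext)
        fix n
        show "fps_nth f n = fps_nth (1 + fps_X * fps_shift 1 f) n"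
          by (cases n) (auto simp: f_def simp del: fps_hypergeo_nth)
      qed
      then have "F x = eval_fps (1 + fps_X * fps_shift 1 f) x"
        unfolding F_def by simp
      moreover have "fps_conv_radius (fps_X * fps_shift 1 f) = \<infinity>"
        using fps_conv_radius_mult[of fps_X "fps_shift 1 f"] by (simp add: radius)
      ultimately show ?thesis
        by (simp add: eval_fps_mult eval_fps_add radius R_def)
    qed
    have F'R: "F' x = R x + x * R' x" for x
    proof (rule DERIV_unique[OF dF])
      have "((\<lambda>x. 1 + x * R x) has_real_derivative R x + x * R' x) (at x)"
        by (auto intro!: derivative_eq_intros dR)
      then show "(F has_real_derivative R x + x * R' x) (at x)"
        unfolding FR[abs_def] .
    qed
    have "- R z \<ge> 0"
    proof (rule nonneg_of_deriv_ineq[where e = "a + 1" and f = "\<lambda>x. - R x" and f' = "\<lambda>x. - R' x"])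
      fix x :: real
      assume x: "x < 0"
      have "p * (G x - 1) \<ge> x"
        using eval_0F1_ge[OF p, of x] x p by (simp add: G_def field_simps)
      then have "a * (p * (G x - 1) - x) \<le> 0"
        using False by (intro mult_nonpos_nonneg) auto
      \<comment> \<open>Inserting F = 1 + x R into \<open>key\<close> produces an extra
        \<open>a * x\<close>, which the subtraction of \<open>x\<close> removes.\<close>
      also have "a * (p * (G x - 1) - x) = x\<^sup>2 * (x * R' x + (a + 1) * R x)"
        using key[of x] unfolding FR F'R by (simp add: algebra_simps power2_eq_square)
      finally have "x * R' x + (a + 1) * R x \<le> 0"
        using x by (simp add: mult_le_0_iff)
      then show "x * - R' x + (a + 1) * - R x \<ge> 0"
        by simp
    next
      \<comment> \<open>This coefficient is a / (2 (p + 1) (a + 1)).\<close>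
      have "R 0 = fps_nth f 1"
        by (simp add: R_def eval_fps_at_0)
      also have "\<dots> \<le> 0"
        using False a p f_nth[of 1] by (simp add: divide_nonpos_nonneg)
      finally show "- R 0 \<ge> 0"
        by simp
    qed (use a z in \<open>auto intro!: derivative_eq_intros dR\<close>)
    then show ?thesis
      using z by (simp add: FR mult_nonpos_nonpos)
  qed
  then show ?thesis
    by (simp add: F_def f_def hypergeometric_def)
qed

text \<open>The bounds n \<ge> 1 and \<beta> < n + 4 become \<open>p \<ge> 1 / 2\<close> and
  \<open>a > -1\<close>, as \<open>hypergeometric_nonneg\<close> requires.\<close>

lemma multiplier_nonpos:
  fixes \<nu> :: "real^'n::finite"
  assumes "\<beta> < real CARD('n) + 4"
  shows "multiplier \<delta> \<beta> \<nu> \<le> 0"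
proof -
  define a where "a = (real CARD('n) + 2 - \<beta>) / 2"
  define p where "p = real CARD('n) / 2"
  have "real CARD('n) \<ge> 1"
    using zero_less_card_finite[where 'a = 'n] by linarith
  then have p: "p \<ge> 1 / 2"
    by (simp add: p_def)
  have a: "a > -1"
    using assms by (simp add: a_def)
  have "- (1 / 4) * (norm \<nu>)\<^sup>2 * \<delta>\<^sup>2 \<le> 0"
    by simp
  then have "hypergeometric [1, a] [2, p + 1, a + 1] (- (1 / 4) * (norm \<nu>)\<^sup>2 * \<delta>\<^sup>2) \<ge> 0"
    by (rule hypergeometric_nonneg[OF a p])
  moreover have "a + 1 = (real CARD('n) + 4 - \<beta>) / 2" "p + 1 = (real CARD('n) + 2) / 2"
    by (simp_all add: a_def p_def field_simps)
  ultimately show ?thesis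
    unfolding multiplier_def Let_def a_def by (simp add: mult_nonneg_nonneg)
qed

section \<open>Termwise differentiation\<close>

text \<open>A bound \<open>M k\<close> on the second derivative makes the linearization error of
  each term at most \<open>M k\<close> times (x - t)^2. These errors sum to B (x - t)^2, which is
  o(|x - t|); convexity keeps the segment from t to x inside \<open>S\<close>.\<close>

lemma infsum_has_vector_derivative:
  fixes f f' f'' :: "'k \<Rightarrow> real \<Rightarrow> 'b::banach"
  assumes S: "open S" "convex S" and t: "t \<in> S"
    and f: "\<And>k x. k \<in> A \<Longrightarrow> x \<in> S \<Longrightarrow> (f k has_vector_derivative f' k x) (at x)"
    and f': "\<And>k x. k \<in> A \<Longrightarrow> x \<in> S \<Longrightarrow> (f' k has_vector_derivative f'' k x) (at x)"
    and bound: "\<And>k x. k \<in> A \<Longrightarrow> x \<in> S \<Longrightarrow> norm (f'' k x) \<le> M k"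
    and M: "M summable_on A"
    and sf: "\<And>x. x \<in> S \<Longrightarrow> (\<lambda>k. f k x) summable_on A"
    and sf': "(\<lambda>k. f' k t) summable_on A"
  shows "((\<lambda>x. \<Sum>\<^sub>\<infinity>k\<in>A. f k x) has_vector_derivative (\<Sum>\<^sub>\<infinity>k\<in>A. f' k t)) (at t)"
proof -
  define g where "g x = (\<Sum>\<^sub>\<infinity>k\<in>A. f k x)" for x
  define g' where "g' = (\<Sum>\<^sub>\<infinity>k\<in>A. f' k t)"
  define B where "B = (\<Sum>\<^sub>\<infinity>k\<in>A. M k)"
  have taylor: "norm (g x - g t - (x - t) *\<^sub>R g') \<le> B * \<bar>x - t\<bar>\<^sup>2" if x: "x \<in> S" for x
  proof (rule norm_infsum_le)
    have diff: "((\<lambda>k. u k - v k) has_sum (y - z)) A"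
      if "(u has_sum y) A" "(v has_sum z) A" for u v :: "'k \<Rightarrow> 'b" and y z
      using has_sum_add[OF that(1), of "\<lambda>k. - v k" "- z"] that(2) by (simp add: has_sum_uminus)
    show "((\<lambda>k. f k x - f k t - (x - t) *\<^sub>R f' k t) has_sum (g x - g t - (x - t) *\<^sub>R g')) A"
      unfolding g_def g'_def using sf[OF x] sf[OF t] sf'
      by (intro diff has_sum_scaleR has_sum_infsum)
    show "((\<lambda>k. M k * \<bar>x - t\<bar>\<^sup>2) has_sum (B * \<bar>x - t\<bar>\<^sup>2)) A"
      unfolding B_def by (intro has_sum_cmult_left has_sum_infsum M)
    fix k
    assume k: "k \<in> A"
    have seg: "closed_segment t x \<subseteq> S"
      using S t x by (simp add: closed_segment_subset)
    \<comment> \<open>The mean value inequality is used twice: it bounds the variation of f' on the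
      segment, and this bounds the linearization error of f.\<close>
    have "norm (f k x - f k t - (x - t) *\<^sub>R f' k t) \<le> norm (x - t) * (M k * norm (x - t))"
    proof (rule vector_differentiable_bound_linearization[where S = "closed_segment t x"])
      fix y
      assume y: "y \<in> closed_segment t x"
      show "(f k has_vector_derivative f' k y) (at y within closed_segment t x)"
        using f[OF k] y seg by (blast intro: has_vector_derivative_at_within)
      have "norm (f' k y - f' k t) \<le> M k * norm (y - t)"
      proof (rule differentiable_bound[of "closed_segment t x" "f' k" "\<lambda>u h. h *\<^sub>R f'' k u"])
        fix u
        assume u: "u \<in> closed_segment t x"
        then have uS: "u \<in> S"
          using seg by blast
        show "(f' k has_derivative (\<lambda>h. h *\<^sub>R f'' k u)) (at u within closed_segment t x)"
          using has_vector_derivative_at_within[OF f'[OF k uS]] by (simp add: has_vector_derivative_def)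
        show "onorm (\<lambda>h. h *\<^sub>R f'' k u) \<le> M k"
          using bound[OF k uS] by (intro onorm_le) (simp add: mult.commute[of "M k"] mult_left_mono)
      qed (use y in auto)
      also have "\<dots> \<le> M k * norm (x - t)"
      proof (rule mult_left_mono)
        show "norm (y - t) \<le> norm (x - t)"
          using y by (rule segment_bound1)
        show "M k \<ge> 0"
          using bound[OF k t] norm_ge_zero order_trans by blast
      qed
      finally show "norm (f' k y - f' k t) \<le> M k * norm (x - t)" .
    qed auto
    then show "norm (f k x - f k t - (x - t) *\<^sub>R f' k t) \<le> M k * \<bar>x - t\<bar>\<^sup>2"
      by (simp add: power2_eq_square mult_ac)
  qed
  have B: "B \<ge> 0"
    unfolding B_def using bound[OF _ t] norm_ge_zero order_trans by (intro infsum_nonneg) blast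
  show ?thesis
    unfolding has_vector_derivative_def has_derivative_within_alt g_def[symmetric] g'_def[symmetric]
  proof (intro conjI allI impI)
    show "bounded_linear (\<lambda>h. h *\<^sub>R g')"
      by (rule bounded_linear_scaleR_left)
    fix e :: real
    assume "e > 0"
    obtain d where d: "d > 0" "ball t d \<subseteq> S"
      using S t open_contains_ball by blast
    show "\<exists>d>0. \<forall>y\<in>UNIV. norm (y - t) < d \<longrightarrow> norm (g y - g t - (y - t) *\<^sub>R g') \<le> e * norm (y - t)"
    \<comment> \<open>\<open>B + 1\<close> rather than \<open>B\<close>, which may be 0.\<close>
    proof (intro exI[of _ "min d (e / (B + 1))"] conjI ballI impI)
      show "min d (e / (B + 1)) > 0"
        using d \<open>e > 0\<close> B by simp
      fix y
      assume y: "norm (y - t) < min d (e / (B + 1))"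
      then have "y \<in> S"
        using d by (auto simp: ball_def dist_norm norm_minus_commute)
      then have "norm (g y - g t - (y - t) *\<^sub>R g') \<le> (B * \<bar>y - t\<bar>) * \<bar>y - t\<bar>"
        using taylor[of y] by (simp add: power2_eq_square mult_ac)
      also have "\<dots> \<le> e * \<bar>y - t\<bar>"
      proof (rule mult_right_mono)
        have "B * \<bar>y - t\<bar> \<le> (B + 1) * \<bar>y - t\<bar>"
          by (intro mult_right_mono) auto
        also have "\<dots> \<le> e"
          using y B by (simp add: field_simps)
        finally show "B * \<bar>y - t\<bar> \<le> e" .
      qed simp
      finally show "norm (g y - g t - (y - t) *\<^sub>R g') \<le> e * norm (y - t)"
        by simp
    qed
  qed
qed

text \<open>By induction on j the iterated derivatives agree with \<open>g j\<close> on
  \<open>S\<close>. They may differ elsewhere, but on an open set agreement on \<open>S\<close> is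
  enough to carry derivatives over.\<close>

lemma C_infinity_onI:
  fixes g :: "nat \<Rightarrow> real \<Rightarrow> complex"
  assumes S: "open S"
    and g: "\<And>j t. t \<in> S \<Longrightarrow> (g j has_vector_derivative g (Suc j) t) (at t)"
  shows "C_infinity_on S (g 0)"
proof -
  let ?D = "\<lambda>j. ((\<lambda>g t. vector_derivative g (at t)) ^^ j) (g 0)"
  have D: "(?D j has_vector_derivative g (Suc j) t) (at t)" if "t \<in> S" "\<And>u. u \<in> S \<Longrightarrow> ?D j u = g j u" for j t
    using has_vector_derivative_transform_within_open[OF g[OF that(1)] S that(1)] that(2) by metis
  have eq: "?D j t = g j t" if "t \<in> S" for j t
    using that
  proof (induction j arbitrary: t)
    case (Suc j)
    then show ?case
      using vector_derivative_at[OF D[of t j]] by simp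
  qed simp
  show ?thesis
    unfolding C_infinity_on_def
    using D[OF _ eq] by (meson differentiableI_vector)
qed

text \<open>The \<open>j\<close>-th derivative of \<open>t \<mapsto> (e\<^sup>m\<^sup>t - 1) / m\<close>. Division by zero makes it vanish for
  \<open>m = 0\<close>, as do the terms of the solution.\<close>

definition mode :: "real \<Rightarrow> nat \<Rightarrow> real \<Rightarrow> real" where
  "mode m j t = (m ^ j * exp (m * t) - (if j = 0 then 1 else 0)) / m"

lemma mode_deriv: "(mode m j has_real_derivative mode m (Suc j) t) (at t)"
  unfolding mode_def by (auto intro!: derivative_eq_intros)

text \<open>The bound is uniform in \<open>m\<close>, since the multiplier may be unbounded in k.
  For j = 0 it comes from 0 \<le> 1 - e^(mt) \<le> -mt, for j = i + 1 from the decay of e^(mt)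
  against |m|^i.\<close>

lemma mode_bounded:
  assumes "a > 0"
  obtains B where "\<And>m t. m \<le> 0 \<Longrightarrow> a < t \<Longrightarrow> t < c \<Longrightarrow> \<bar>mode m j t\<bar> \<le> B"
proof (cases j)
  case 0
  have "\<bar>mode m j t\<bar> \<le> c" if "m \<le> 0" "a < t" "t < c" for m t
  proof (cases "m = 0")
    case False
    then have m: "m < 0"
      using that by simp
    have "m * t \<le> 0"
      using that assms by (simp add: mult_nonpos_nonneg)
    then have "\<bar>exp (m * t) - 1\<bar> \<le> - m * t"
      using exp_ge_add_one_self[of "m * t"] exp_le_one_iff[of "m * t"] by linarith
    then have "\<bar>mode m j t\<bar> \<le> t"
      using m 0 by (simp add: mode_def abs_divide field_simps)
    then show ?thesis
      using that by simp
  qed (use that assms 0 in \<open>simp add: mode_def\<close>)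
  then show ?thesis
    by (rule that)
next
  case (Suc i)
  have "\<bar>mode m j t\<bar> \<le> fact i / a ^ i" if "m \<le> 0" "a < t" "t < c" for m t
  proof (cases "m = 0")
    case False
    then have m: "m < 0"
      using that by simp
    \<comment> \<open>A single term of the exponential series, all of whose terms are nonnegative
      here.\<close>
    have "(- m * a) ^ i / fact i \<le> exp (- m * a)"
    proof -
      have "(\<Sum>n\<in>{i}. (- m * a) ^ n /\<^sub>R fact n) \<le> (\<Sum>n. (- m * a) ^ n /\<^sub>R fact n)"
        using m assms by (intro sum_le_suminf summable_exp_generic)
          (auto simp: mult_nonpos_nonneg intro!: mult_nonneg_nonneg zero_le_power)
      then show ?thesis
        by (simp add: exp_def divide_inverse mult.commute)
    qed
    then have "(- m) ^ i * a ^ i / fact i \<le> inverse (exp (m * a))"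
      by (simp add: exp_minus flip: power_mult_distrib)
    then have "(- m) ^ i * exp (m * a) \<le> fact i / a ^ i"
      using assms by (simp add: field_simps)
    moreover have "(- m) ^ i * exp (m * t) \<le> (- m) ^ i * exp (m * a)"
      using m that by (intro mult_left_mono) auto
    moreover have "\<bar>mode m j t\<bar> = (- m) ^ i * exp (m * t)"
      using m Suc by (simp add: mode_def abs_mult power_abs)
    ultimately show ?thesis
      by simp
  qed (use assms Suc in \<open>simp add: mode_def\<close>)
  then show ?thesis
    by (rule that)
qed

section \<open>Smoothness of the solution in time\<close>

theorem proposition4:
  fixes r :: "real^'n::finite" and \<delta> \<beta> s :: real
    and b :: "(real^'n \<Rightarrow> complex) \<Rightarrow> complex"
  assumes "\<forall>i. r $ i > 0"
    and "\<delta> > 0"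
    and "\<beta> < real CARD('n) + 4"
    and "b \<in> sobolev r s"
    and "(\<lambda>k. cmod (fourier_coeff r b k)) summable_on UNIV"
  shows "\<forall>x\<in>cbox 0 r. C_infinity_on {0<..} (solution r \<delta> \<beta> b x)"
proof
  fix x :: "real^'n"
  define m where "m k = multiplier \<delta> \<beta> (freq r k)" for k
  define c where "c k = fourier_coeff r b k * cis (freq r k \<bullet> x)" for k
  \<comment> \<open>\<open>f j k\<close> is the j-th time derivative of the term with index k,
    \<open>p j\<close> that of the separate term with index 0, and \<open>g j\<close> the candidate
    for that of the solution.\<close>
  define f where "f j k t = of_real (mode (m k) j t) * c k" for j k t
  define p where "p j t = fourier_coeff r b 0 * of_real (if j = 0 then t else if j = 1 then 1 else 0)"
    for j :: nat and t :: real
  define g where "g j t = p j t + (\<Sum>\<^sub>\<infinity>k\<in>UNIV - {0}. f j k t)" for j t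
  have c: "(\<lambda>k. norm (c k)) summable_on UNIV - {0}"
    using summable_on_subset_banach[OF assms(5), of "UNIV - {0}"] by (simp add: c_def norm_mult)
  \<comment> \<open>The interval is bounded because the bound for j = 0 grows with its right
    end.\<close>
  have bound: "\<exists>M. M summable_on UNIV - {0} \<and> (\<forall>k. \<forall>t\<in>{a<..<d}. norm (f j k t) \<le> M k)"
    if a: "a > 0" for a d j
  proof -
    obtain B where B: "\<And>m t. m \<le> 0 \<Longrightarrow> a < t \<Longrightarrow> t < d \<Longrightarrow> \<bar>mode m j t\<bar> \<le> B"
      using mode_bounded[OF a] by metis
    have "norm (f j k t) \<le> B * norm (c k)" if "t \<in> {a<..<d}" for k t
      using B[of "m k" t] that multiplier_nonpos[OF assms(3)]
      by (simp add: f_def m_def norm_mult mult_right_mono)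
    moreover have "(\<lambda>k. B * norm (c k)) summable_on UNIV - {0}"
      using c by (rule summable_on_cmult_right)
    ultimately show ?thesis
      by blast
  qed
  have f_deriv: "(f j k has_vector_derivative f (Suc j) k t) (at t)" for j k t
    unfolding f_def using mode_deriv[of "m k" j t]
    by (intro has_vector_derivative_mult_left has_vector_derivative_of_real)
      (simp add: has_real_derivative_iff_has_vector_derivative)
  have summable: "(\<lambda>k. f j k t) summable_on UNIV - {0}" if "t > 0" for j t
  proof -
    obtain M where "M summable_on UNIV - {0}" "\<forall>k. \<forall>u\<in>{t / 2<..<t + 1}. norm (f j k u) \<le> M k"
      using bound[of "t / 2" "t + 1" j] \<open>t > 0\<close> by auto
    then have "(\<lambda>k. norm (f j k t)) summable_on UNIV - {0}"
      using \<open>t > 0\<close> by (intro Infinite_Sum.abs_summable_on_comparison_test'[where g = M]) auto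
    then show ?thesis
      by (rule abs_summable_summable)
  qed
  have "C_infinity_on {0<..} (g 0)"
  proof (rule C_infinity_onI)
    fix j and t :: real
    assume "t \<in> {0<..}"
    then have t: "t > 0"
      by simp
    \<comment> \<open>Two orders up, because termwise differentiation of \<open>f j\<close> needs a
      bound on second derivatives; the interval surrounds \<open>t\<close> and stays away from
      0.\<close>
    obtain M where M: "M summable_on UNIV - {0}"
        "\<forall>k. \<forall>u\<in>{t / 2<..<t + 1}. norm (f (Suc (Suc j)) k u) \<le> M k"
      using bound[of "t / 2" "t + 1" "Suc (Suc j)"] t by auto
    have "((\<lambda>t. \<Sum>\<^sub>\<infinity>k\<in>UNIV - {0}. f j k t) has_vector_derivative
        (\<Sum>\<^sub>\<infinity>k\<in>UNIV - {0}. f (Suc j) k t)) (at t)"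
      using t M summable
      by (intro infsum_has_vector_derivative[where S = "{t / 2<..<t + 1}" and f = "f j"
            and f' = "f (Suc j)" and f'' = "f (Suc (Suc j))" and M = M] f_deriv) auto
    moreover have "(p j has_vector_derivative p (Suc j) t) (at t)"
      unfolding p_def
      by (cases j) (auto intro!: derivative_eq_intros simp: has_vector_derivative_of_real)
    ultimately show "(g j has_vector_derivative g (Suc j) t) (at t)"
      unfolding g_def by (intro has_vector_derivative_add)
  qed simp
  moreover have "g 0 = solution r \<delta> \<beta> b x"
    by (simp add: fun_eq_iff g_def p_def f_def c_def m_def mode_def solution_def mult.assoc)
  ultimately show "C_infinity_on {0<..} (solution r \<delta> \<beta> b x)"
    by simp
qed

end
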